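(* An assembly with parameters $\{a_j\}_{j\ge 1}$, $a_j>0$, converges if and only if the sequence $\{a_j\}_{j\ge 1}$ is such that $\tilde g\in RT_\rho$ for some $0\le\rho<\infty$, where $\tilde g(x)=\exp\big(\sum_{j\ge 1}a_jx^j\big)$.
   Context: An assembly with parameters $a_j>0$, $j\ge 1$, is the random structure induced by independent random variables $Z_j\sim \mathrm{Poisson}(a_j)$, $j\ge1$: its counting process $\{\mathbf{K}^{(n)}=(K^{(n)}_1,\dots,K^{(n)}_n),\ n\ge 1\}$ is defined by $\mathcal{L}(\mathbf{K}^{(n)})=\mathcal{L}\big(Z_1,\dots,Z_n\,\big|\,\sum_{j=1}^n jZ_j=n\big)$. The random structure is said to converge if for each fixed $l\ge 1$ the law of $(K^{(n)}_1,\dots,K^{(n)}_l)$ converges weakly, as $n\to\infty$, to some probability law on $\mathbb{R}^l$; otherwise it diverges. $\tilde g$ is regarded as a formal power series. For $0\le\rho\le\infty$, $RT_\rho$ is the collection of sequences $\{d_n\}$ of nonnegative numbers with $\lim_{n\to\infty}d_n/d_{n+1}=\rho$; a power series $\sum_{n}d_nx^n$ is said to be in $RT_\rho$ if $\{d_n\}\in RT_\rho$. *)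

theory Defs
  imports "HOL-Probability.Probability" "HOL-Computational_Algebra.Computational_Algebra"
begin

text \<open>
  Sequences and processes attached to an assembly are indexed by \<open>j \<ge> 1\<close>; the values at \<open>j = 0\<close> are
  never used.
\<close>

locale assembly = prob_space M
  for M :: "'m measure" and a :: "nat \<Rightarrow> real" and Z :: "nat \<Rightarrow> 'm \<Rightarrow> nat" +
  assumes param_pos: "\<And>j. j \<ge> 1 \<Longrightarrow> a j > 0"
    and indep_Z: "indep_vars (\<lambda>_. count_space UNIV) Z {1..}"
    and law_Z: "\<And>j. j \<ge> 1 \<Longrightarrow>
      distr M (count_space UNIV) (Z j) = measure_pmf (poisson_pmf (a j))"

text \<open>
  Conditioning on an event of positive probability is \<^const>\<open>uniform_measure\<close>. For an
  assembly and \<open>n \<ge> 1\<close> the event below contains \<open>{Z 1 = n, Z 2 = \<dots> = Z n = 0}\<close>, so its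
  probability is positive.
\<close>

definition counting_law :: "'m measure \<Rightarrow> (nat \<Rightarrow> 'm \<Rightarrow> nat) \<Rightarrow> nat \<Rightarrow> (nat \<Rightarrow> nat) measure" where
  "counting_law M Z n =
    distr (uniform_measure M {\<omega> \<in> space M. (\<Sum>j = 1..n. j * Z j \<omega>) = n})
      (\<Pi>\<^sub>M j\<in>{1..n}. count_space UNIV) (\<lambda>\<omega>. \<lambda>j\<in>{1..n}. Z j \<omega>)"

text \<open>
  \<open>\<real>\<^sup>l\<close> is the set of functions on \<open>{1..l}\<close> (extended by \<^const>\<open>undefined\<close>), with the product
  topology and the product of the Borel \<open>\<sigma>\<close>-algebras, which is the Borel \<open>\<sigma>\<close>-algebra of that
  topology.
\<close>

abbreviation Rl_top :: "nat \<Rightarrow> (nat \<Rightarrow> real) topology" where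
  "Rl_top l \<equiv> product_topology (\<lambda>_. euclideanreal) {1..l}"

abbreviation Rl_borel :: "nat \<Rightarrow> (nat \<Rightarrow> real) measure" where
  "Rl_borel l \<equiv> (\<Pi>\<^sub>M j\<in>{1..l}. borel)"

definition weak_conv_Rl ::
  "nat \<Rightarrow> (nat \<Rightarrow> (nat \<Rightarrow> real) measure) \<Rightarrow> (nat \<Rightarrow> real) measure \<Rightarrow> bool" where
  "weak_conv_Rl l \<mu> \<nu> \<longleftrightarrow>
    (\<forall>f. continuous_map (Rl_top l) euclideanreal f \<and> bounded (f ` topspace (Rl_top l)) \<longrightarrow>
      (\<lambda>n. \<integral>x. f x \<partial>\<mu> n) \<longlonglongrightarrow> (\<integral>x. f x \<partial>\<nu>))"

text \<open>
  The law of the first \<open>l\<close> counts is meaningful only for \<open>n \<ge> l\<close>; for the finitely many \<open>n < l\<close>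
  the missing coordinates are constant, which does not affect the limit in \<open>n\<close>.
\<close>

definition marginal_law ::
  "'m measure \<Rightarrow> (nat \<Rightarrow> 'm \<Rightarrow> nat) \<Rightarrow> nat \<Rightarrow> nat \<Rightarrow> (nat \<Rightarrow> real) measure" where
  "marginal_law M Z l n =
    distr (counting_law M Z n) (Rl_borel l) (\<lambda>k. \<lambda>j\<in>{1..l}. real (k j))"

definition structure_converges :: "'m measure \<Rightarrow> (nat \<Rightarrow> 'm \<Rightarrow> nat) \<Rightarrow> bool" where
  "structure_converges M Z \<longleftrightarrow>
    (\<forall>l\<ge>1. \<exists>\<nu>. prob_space \<nu> \<and> sets \<nu> = sets (Rl_borel l) \<and>
      weak_conv_Rl l (marginal_law M Z l) \<nu>)"

definition assembly_gf :: "(nat \<Rightarrow> real) \<Rightarrow> real fps" where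
  "assembly_gf a = fps_exp 1 oo Abs_fps (\<lambda>j. if j = 0 then 0 else a j)"

text \<open>
  The quotients \<open>d n / d (n + 1)\<close> must make sense for all large \<open>n\<close>; this excludes quotients
  by zero, which have the value \<open>0\<close> in HOL.
\<close>

definition RT :: "ereal \<Rightarrow> (nat \<Rightarrow> real) set" where
  "RT \<rho> = {d. (\<forall>n. d n \<ge> 0) \<and> (\<forall>\<^sub>F n in sequentially. d n \<noteq> 0) \<and>
    (\<lambda>n. ereal (d n / d (Suc n))) \<longlonglongrightarrow> \<rho>}"

end

theory Submission imports Defs begin

text \<open>
  Let \<open>c n\<close> be the coefficients of the generating function and \<open>c l n\<close> those of
  \<open>exp (\<Sum>j>l. a j x^j)\<close>. Independence gives, for \<open>s = \<Sum>j\<le>l. j * k j\<close>,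
  that \<open>K 1 = k 1, \<dots>, K l = k l\<close> has probability
  \<open>(\<Prod>j\<le>l. a j ^ k j / fact (k j)) * c l (n - s) / c n\<close> in the structure of size \<open>n\<close>.

  If the structure converges, then already for \<open>l = 1\<close> the quotients \<open>c 1 (n - k) / c n\<close> converge for
  every \<open>k\<close>, and by tightness some limit \<open>q k\<close> is nonzero. Since \<open>c (n - 1) / c n\<close> is the quotient of
  \<open>c 1 (n - 1 - k) / c n\<close> and \<open>c 1 (n - 1 - k) / c (n - 1)\<close>, it tends to \<open>q (k + 1) / q k\<close>.

  Conversely, if \<open>c (n - 1) / c n\<close> converges, it is bounded by some \<open>R\<close>, so \<open>c (n - m) / c n \<le> R ^ m\<close>.
  Hence \<open>c l (n - s) / c n\<close> converges and is bounded by \<open>R ^ s\<close>, where \<open>R ^ (\<Sum>j\<le>l. j * Z j)\<close> is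
  integrable; dominated convergence gives the weak limit.
\<close>

unbundle no vec_syntax

section \<open>Exponentials of formal power series\<close>

text \<open>A formal power series over the reals with derivative 0 is its constant term. The
  products \<open>?E f * ?E (- f)\<close> and \<open>?E (f + g) * (?E (- f) * ?E (- g))\<close> have
  derivative 0 and constant term 1, so both equal 1.\<close>

lemma fps_exp_compose_add:
  fixes f g :: "real fps"
  assumes f: "f $ 0 = 0" and g: "g $ 0 = 0"
  shows "fps_exp 1 oo (f + g) = (fps_exp 1 oo f) * (fps_exp 1 oo g)"
proof -
  let ?E = "\<lambda>f::real fps. fps_exp 1 oo f"
  have deriv: "fps_deriv (?E f) = ?E f * fps_deriv f" if "f $ 0 = 0" for f
    using that by (simp add: fps_compose_deriv)
  have inv: "?E f * ?E (- f) = 1" if "f $ 0 = 0" for f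
  proof -
    have "fps_deriv (?E f * ?E (- f)) = 0"
      using that by (simp add: deriv algebra_simps)
    then show ?thesis
      unfolding fps_deriv_eq_0_iff by simp
  qed
  have "fps_deriv (?E (f + g) * (?E (- f) * ?E (- g))) = 0"
    using f g by (simp add: deriv algebra_simps)
  then have "?E (f + g) * (?E (- f) * ?E (- g)) = 1"
    unfolding fps_deriv_eq_0_iff by simp
  then have "?E (f + g) * ((?E f * ?E (- f)) * (?E g * ?E (- g))) = ?E f * ?E g"
    by (metis (no_types, opaque_lifting) mult.assoc mult.commute mult_1)
  then show ?thesis
    by (simp only: inv f g mult_1_right)
qed

lemma fps_power_nth_cong:
  fixes f g :: "'a::comm_semiring_1 fps"
  assumes "\<And>j. j \<le> n \<Longrightarrow> f $ j = g $ j"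
  shows "(f ^ i) $ n = (g ^ i) $ n"
proof -
  have "\<forall>m\<le>n. (f ^ i) $ m = (g ^ i) $ m"
  proof (induction i)
    case (Suc i)
    then show ?case
      using assms by (auto simp: fps_mult_nth intro!: sum.cong)
  qed simp
  then show ?thesis by simp
qed

lemma fps_power_nth_nonneg:
  fixes f :: "real fps"
  assumes "\<And>j. f $ j \<ge> 0"
  shows "(f ^ i) $ n \<ge> 0"
proof (induction i arbitrary: n)
  case (Suc i)
  then show ?case
    using assms by (auto simp: fps_mult_nth intro!: sum_nonneg)
qed simp

section \<open>Generating functions of structures with restricted component sizes\<close>

text \<open>Here \<open>{0<..}\<close> gives the full generating function and \<open>{l<..}\<close>
  the series with coefficients \<open>c l n\<close>. Finite index sets connect to the probabilities
  below, infinite ones remove the dependence on \<open>n\<close>.\<close>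

definition gf_on :: "(nat \<Rightarrow> real) \<Rightarrow> nat set \<Rightarrow> real fps" where
  "gf_on a I = fps_exp 1 oo Abs_fps (\<lambda>j. if j \<in> I then a j else 0)"

lemma assembly_gf_eq_gf_on: "assembly_gf a = gf_on a {0<..}"
  unfolding assembly_gf_def gf_on_def
  by (rule arg_cong[where f = "fps_compose _"]) (auto simp: fps_eq_iff)

lemma gf_on_empty: "gf_on a {} = 1"
  by (simp add: gf_on_def flip: fps_zero_def)

lemma gf_on_nth_0 [simp]: "gf_on a I $ 0 = 1"
  by (simp add: gf_on_def)

lemma gf_on_Un:
  assumes "I \<inter> J = {}" "0 \<notin> I" "0 \<notin> J"
  shows "gf_on a (I \<union> J) = gf_on a I * gf_on a J"
proof -
  have "Abs_fps (\<lambda>j. if j \<in> I \<union> J then a j else 0) =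
      Abs_fps (\<lambda>j. if j \<in> I then a j else 0) + Abs_fps (\<lambda>j. if j \<in> J then a j else 0)"
    using assms by (auto simp: fps_eq_iff)
  then show ?thesis
    using assms unfolding gf_on_def by (simp add: fps_exp_compose_add)
qed

text \<open>Coefficient \<open>m\<close> of each power of the exponent depends only on coefficients
  up to \<open>m\<close>. This is what lets \<open>{0<..}\<close> replace \<open>{1..n}\<close>, and
  \<open>{l<..}\<close> replace \<open>{l<..n}\<close>.\<close>

lemma gf_on_nth_cong:
  assumes "\<And>j. j \<le> m \<Longrightarrow> j \<in> I \<longleftrightarrow> j \<in> J"
  shows "gf_on a I $ m = gf_on a J $ m"
  unfolding gf_on_def fps_compose_nth
proof (intro sum.cong refl arg_cong2[where f = "(*)"] fps_power_nth_cong)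
  fix j assume "j \<le> m"
  then show "Abs_fps (\<lambda>j. if j \<in> I then a j else 0) $ j = Abs_fps (\<lambda>j. if j \<in> J then a j else 0) $ j"
    using assms by simp
qed

lemma gf_on_nth_nonneg:
  assumes "\<And>j. j \<in> I \<Longrightarrow> a j \<ge> 0"
  shows "gf_on a I $ m \<ge> 0"
  unfolding gf_on_def fps_compose_nth
  using assms by (intro sum_nonneg mult_nonneg_nonneg fps_power_nth_nonneg) auto

text \<open>The series is \<open>exp (a j * x ^ j)\<close>; up to the factor
  \<open>exp (- a j)\<close> its coefficients are the Poisson weights, placed at the multiples of
  \<open>j\<close>.\<close>

lemma gf_on_singleton:
  assumes "j > 0"
  shows "gf_on a {j} $ m = (if j dvd m then a j ^ (m div j) / fact (m div j) else 0)"
proof -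
  have "Abs_fps (\<lambda>i. if i \<in> {j} then a i else 0) = fps_const (a j) * fps_X ^ j"
    by (auto simp: fps_eq_iff)
  moreover have "((fps_const (a j) * fps_X ^ j) ^ i) $ m = a j ^ i * (if m = j * i then 1 else 0)" for i
    by (simp add: power_mult_distrib fps_const_power fps_X_power_nth flip: power_mult)
  ultimately have "gf_on a {j} $ m = (\<Sum>i = 0..m. a j ^ i / fact i * (if m = j * i then 1 else 0))"
    by (simp add: gf_on_def fps_compose_nth)
  also have "\<dots> = (\<Sum>i = 0..m. if i = m div j \<and> j dvd m then a j ^ i / fact i else 0)"
    using assms by (intro sum.cong) auto
  also have "\<dots> = (if j dvd m then a j ^ (m div j) / fact (m div j) else 0)"
    by (auto simp: sum.delta)
  finally show ?thesis .
qed

text \<open>Powers of \<open>- f\<close> and \<open>f\<close> agree up to sign, so the triangle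
  inequality suffices. It supplies a majorant for the reciprocal of
  \<open>fps_exp 1 oo f\<close>.\<close>

lemma abs_fps_exp_compose_uminus_le:
  fixes f :: "real fps"
  assumes "\<And>j. f $ j \<ge> 0"
  shows "\<bar>(fps_exp 1 oo (- f)) $ m\<bar> \<le> (fps_exp 1 oo f) $ m"
proof -
  have "\<bar>((- f) ^ i) $ m\<bar> = (f ^ i) $ m" for i
    using fps_power_nth_nonneg[OF assms]
    by (cases "even i") (simp_all add: power_minus_odd)
  then show ?thesis
    unfolding fps_compose_nth
    by (intro order_trans[OF sum_abs] sum_mono) (simp add: abs_mult)
qed

section \<open>Counts conditioned on the total size\<close>

lemma measurable_restrict_of_nat:
  assumes "l \<le> m"
  shows "(\<lambda>k. \<lambda>j\<in>{1..l}. real (k j)) \<in> measurable (\<Pi>\<^sub>M j\<in>{1..m}. count_space UNIV) (Rl_borel l)"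
  using assms by (intro measurable_restrict) (auto intro!: measurable_compose[OF measurable_component_singleton])

context assembly
begin

section \<open>Total sizes of blocks of independent Poisson components\<close>

definition size_on :: "nat set \<Rightarrow> 'm \<Rightarrow> nat" where
  "size_on I \<omega> = (\<Sum>j\<in>I. j * Z j \<omega>)"

lemma measurable_Z: "j \<ge> 1 \<Longrightarrow> Z j \<in> measurable M (count_space UNIV)"
  using indep_Z by (auto simp: indep_vars_def)

lemma measurable_head: "(\<lambda>\<omega>. \<lambda>j\<in>{1..m}. Z j \<omega>) \<in> measurable M (\<Pi>\<^sub>M j\<in>{1..m}. count_space UNIV)"
  by (intro measurable_restrict measurable_Z) auto

lemma measurable_size_on [measurable]:
  assumes "I \<subseteq> {1..}"
  shows "size_on I \<in> measurable M (count_space UNIV)"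
proof -
  have [measurable]: "Z j \<in> measurable M (count_space UNIV)" if "j \<in> I" for j
    using assms that by (intro measurable_Z) auto
  show ?thesis
    unfolding size_on_def by measurable
qed

text \<open>Disjoint blocks of an independent family are independent. The function \<open>g\<close>
  sees the whole block over \<open>I\<close>, while the block over \<open>J\<close> enters only
  through its discrete total size, so any \<open>\<phi>\<close> with values in the target space is
  measurable.\<close>

lemma indep_var_size_on:
  fixes \<phi> :: "nat \<Rightarrow> 'b" and g :: "(nat \<Rightarrow> nat) \<Rightarrow> 'b"
  assumes "I \<inter> J = {}" "I \<subseteq> {1..}" "J \<subseteq> {1..}"
    and g: "g \<in> measurable (\<Pi>\<^sub>M j\<in>I. count_space UNIV) N" and \<phi>: "\<phi> \<in> UNIV \<rightarrow> space N'"
  shows "indep_var N (\<lambda>\<omega>. g (\<lambda>j\<in>I. Z j \<omega>)) N' (\<lambda>\<omega>. \<phi> (size_on J \<omega>))"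
proof -
  have "(\<lambda>k. \<Sum>j\<in>J. j * k j) \<in> measurable (\<Pi>\<^sub>M j\<in>J. count_space UNIV) (count_space (UNIV :: nat set))"
    by measurable
  then have "(\<lambda>k. \<phi> (\<Sum>j\<in>J. j * k j)) \<in> measurable (\<Pi>\<^sub>M j\<in>J. count_space UNIV) N'"
    by (rule measurable_compose) (use \<phi> in simp)
  from indep_var_compose[OF indep_var_restrict[OF indep_Z assms(1-3)] g this]
  show ?thesis
    by (simp add: comp_def size_on_def[abs_def])
qed

lemma indep_var_size_on_size_on:
  assumes "I \<inter> J = {}" "I \<subseteq> {1..}" "J \<subseteq> {1..}"
  shows "indep_var (count_space UNIV) (size_on I) (count_space UNIV) (size_on J)"
proof -
  have "(\<lambda>k. \<Sum>j\<in>I. j * k j) \<in> measurable (\<Pi>\<^sub>M j\<in>I. count_space UNIV) (count_space (UNIV :: nat set))"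
    by measurable
  from indep_var_size_on[OF assms this, of "\<lambda>i. i" "count_space UNIV"]
  show ?thesis
    by (simp add: size_on_def[abs_def])
qed

text \<open>Splitting by the value of \<open>size_on I\<close> gives the same convolution as
  multiplying the two generating functions.\<close>

lemma prob_size_on_Un:
  assumes "I \<inter> J = {}" "I \<subseteq> {1..}" "J \<subseteq> {1..}" "finite I" "finite J"
  shows "\<P>(\<omega> in M. size_on (I \<union> J) \<omega> = m) =
    (\<Sum>i\<le>m. \<P>(\<omega> in M. size_on I \<omega> = i) * \<P>(\<omega> in M. size_on J \<omega> = m - i))"
proof -
  note [measurable] = measurable_size_on[OF assms(2)] measurable_size_on[OF assms(3)]
  let ?A = "\<lambda>i. {\<omega>\<in>space M. size_on I \<omega> = i \<and> size_on J \<omega> = m - i}"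
  have "size_on (I \<union> J) \<omega> = size_on I \<omega> + size_on J \<omega>" for \<omega>
    unfolding size_on_def using assms by (intro sum.union_disjoint) auto
  then have "{\<omega>\<in>space M. size_on (I \<union> J) \<omega> = m} = (\<Union>i\<in>{..m}. ?A i)"
    by auto
  then have "\<P>(\<omega> in M. size_on (I \<union> J) \<omega> = m) = (\<Sum>i\<le>m. prob (?A i))"
    by (simp only:) (rule finite_measure_finite_Union, auto simp: disjoint_family_on_def)
  moreover have "prob (?A i) = \<P>(\<omega> in M. size_on I \<omega> = i) * \<P>(\<omega> in M. size_on J \<omega> = m - i)" for i
    using indep_varD[OF indep_var_size_on_size_on[OF assms(1-3)], of "{i}" "{m - i}"]
    by (simp add: vimage_def Int_def conj_commute)
  ultimately show ?thesis by simp
qed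

lemma prob_size_on_singleton:
  assumes "j \<ge> 1"
  shows "\<P>(\<omega> in M. size_on {j} \<omega> = m) = exp (- a j) * gf_on a {j} $ m"
proof (cases "j dvd m")
  case True
  then obtain k where k: "m = j * k" by blast
  have "\<P>(\<omega> in M. size_on {j} \<omega> = m) = measure (distr M (count_space UNIV) (Z j)) {k}"
    using assms k
    by (subst measure_distr) (auto simp: measurable_Z size_on_def intro!: arg_cong[where f = prob])
  also have "\<dots> = pmf (poisson_pmf (a j)) k"
    using assms by (simp add: law_Z pmf.rep_eq)
  finally show ?thesis
    using assms k by (simp add: gf_on_singleton param_pos)
next
  case False
  then have "{\<omega>\<in>space M. size_on {j} \<omega> = m} = {}"
    by (auto simp: size_on_def)
  then show ?thesis
    using assms False by (simp only: gf_on_singleton) simp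
qed

text \<open>A disjoint union becomes a convolution on both sides, so induction on \<open>I\<close>
  reduces the claim to one Poisson variable. Thus \<open>gf_on a I\<close> is, up to a constant, the
  probability generating function of the block size.\<close>

lemma prob_size_on:
  assumes "finite I" "I \<subseteq> {1..}"
  shows "\<P>(\<omega> in M. size_on I \<omega> = m) = exp (- (\<Sum>j\<in>I. a j)) * gf_on a I $ m"
  using assms
proof (induction I arbitrary: m rule: finite_induct)
  case empty
  show ?case
    by (auto simp: size_on_def gf_on_empty prob_space)
next
  case (insert j I)
  have j: "j \<ge> 1"
    using insert.prems by simp
  have gf: "gf_on a ({j} \<union> I) = gf_on a {j} * gf_on a I"
    using insert by (intro gf_on_Un) auto
  have "\<P>(\<omega> in M. size_on ({j} \<union> I) \<omega> = m) =
      (\<Sum>i\<le>m. (exp (- a j) * gf_on a {j} $ i) * (exp (- (\<Sum>j\<in>I. a j)) * gf_on a I $ (m - i)))"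
    using insert by (subst prob_size_on_Un) (auto simp: prob_size_on_singleton)
  also have "\<dots> = exp (- (a j + (\<Sum>j\<in>I. a j))) * (\<Sum>i\<le>m. gf_on a {j} $ i * gf_on a I $ (m - i))"
    by (simp add: sum_distrib_left exp_add exp_diff exp_minus field_simps)
  also have "(\<Sum>i\<le>m. gf_on a {j} $ i * gf_on a I $ (m - i)) = gf_on a ({j} \<union> I) $ m"
    by (simp only: gf fps_mult_nth atMost_atLeast0)
  finally show ?case
    using insert by simp
qed

text \<open>Components of size 1 alone already contribute \<open>a 1 ^ n / fact n\<close>.
  Positivity makes the conditioning event non-null and all ratios of coefficients
  meaningful.\<close>

lemma gf_on_all_nth_pos: "gf_on a {0<..} $ n > 0"
proof -
  have "{0<..} = {1} \<union> {1::nat<..}"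
    by auto
  then have "gf_on a {0<..} $ n = (\<Sum>i=0..n. gf_on a {1} $ i * gf_on a {1<..} $ (n - i))"
    by (simp only:) (subst gf_on_Un; simp add: fps_mult_nth)
  \<comment> \<open>Only the summand \<open>i = n\<close> is kept; its second factor is the constant
    coefficient 1.\<close>
  also have "\<dots> \<ge> (\<Sum>i\<in>{n}. gf_on a {1} $ i * gf_on a {1<..} $ (n - i))"
    using param_pos by (intro sum_mono2 mult_nonneg_nonneg gf_on_nth_nonneg) (auto simp: less_imp_le)
  finally have "gf_on a {0<..} $ n \<ge> gf_on a {1} $ n"
    by simp
  then show ?thesis
    using param_pos[of 1] by (simp add: gf_on_singleton) (meson divide_pos_pos fact_gt_zero less_le_trans zero_less_power)
qed

lemma prob_size_on_all:
  assumes "n \<ge> 1"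
  shows "\<P>(\<omega> in M. size_on {1..n} \<omega> = n) = exp (- (\<Sum>j=1..n. a j)) * gf_on a {0<..} $ n"
proof -
  have "gf_on a {1..n} $ n = gf_on a {0<..} $ n"
    by (rule gf_on_nth_cong) auto
  then show ?thesis
    by (subst prob_size_on) auto
qed

text \<open>Sizes above \<open>n\<close> cannot influence a coefficient of index at most
  \<open>n\<close>. The only remaining trace of \<open>n\<close> is the exponential factor, which
  cancels in the conditional law.\<close>

lemma prob_size_on_tail:
  assumes "m \<le> n"
  shows "\<P>(\<omega> in M. size_on {l<..n} \<omega> = m) = exp (- (\<Sum>j\<in>{l<..n}. a j)) * gf_on a {l<..} $ m"
proof -
  have "gf_on a {l<..n} $ m = gf_on a {l<..} $ m"
    using assms by (intro gf_on_nth_cong) auto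
  then show ?thesis
    by (subst prob_size_on) auto
qed

text \<open>This integrates out the components of size above \<open>l\<close>: once the event is
  split by their total size \<open>m\<close>, independence factorises every term.\<close>

lemma integral_head_size_on:
  fixes h :: "(nat \<Rightarrow> nat) \<Rightarrow> real"
  assumes h [measurable]: "h \<in> borel_measurable (\<Pi>\<^sub>M j\<in>{1..l}. count_space UNIV)"
    and B: "\<And>\<omega>. \<omega> \<in> space M \<Longrightarrow> \<bar>h (\<lambda>j\<in>{1..l}. Z j \<omega>)\<bar> \<le> B" and "l \<le> n"
  shows "(\<integral>\<omega>. h (\<lambda>j\<in>{1..l}. Z j \<omega>) * indicat_real {\<omega>\<in>space M. size_on {1..n} \<omega> = n} \<omega> \<partial>M) =
    (\<integral>\<omega>. h (\<lambda>j\<in>{1..l}. Z j \<omega>) * (if size_on {1..l} \<omega> \<le> n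
      then \<P>(\<omega>' in M. size_on {l<..n} \<omega>' = n - size_on {1..l} \<omega>) else 0) \<partial>M)"
proof -
  let ?X = "\<lambda>\<omega>. \<lambda>j\<in>{1..l}. Z j \<omega>"
  have [measurable]: "?X \<in> measurable M (\<Pi>\<^sub>M j\<in>{1..l}. count_space UNIV)"
    by (rule measurable_head)
  have [measurable]: "size_on {1..l} \<in> measurable M (count_space UNIV)"
      "size_on {l<..n} \<in> measurable M (count_space UNIV)"
    by (intro measurable_size_on; auto)+
  define s where "s k = (\<Sum>j\<in>{1..l}. j * k j)" for k :: "nat \<Rightarrow> nat"
  have [measurable]: "s \<in> measurable (\<Pi>\<^sub>M j\<in>{1..l}. count_space UNIV) (count_space UNIV)"
    unfolding s_def by measurable
  have sX: "s (?X \<omega>) = size_on {1..l} \<omega>" for \<omega>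
    by (simp add: s_def size_on_def)
  \<comment> \<open>Absorbing the constraint on the head size into \<open>g m\<close> makes it a
    function of the head alone, hence independent of the tail indicator \<open>?T m\<close>.\<close>
  define g where "g m k = h k * (if s k + m = n then 1 else 0)" for m k
  have [measurable]: "g m \<in> borel_measurable (\<Pi>\<^sub>M j\<in>{1..l}. count_space UNIV)" for m
    unfolding g_def by measurable
  let ?T = "\<lambda>m \<omega>. if size_on {l<..n} \<omega> = m then 1 else (0 :: real)"
  have int_g: "integrable M (\<lambda>\<omega>. g m (?X \<omega>))" for m
  proof (rule integrable_const_bound[where B = "\<bar>B\<bar>"])
    show "AE \<omega> in M. norm (g m (?X \<omega>)) \<le> \<bar>B\<bar>"
      using B by (intro AE_I2) (fastforce simp: g_def)
    show "(\<lambda>\<omega>. g m (?X \<omega>)) \<in> borel_measurable M"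
      by measurable
  qed
  have int_T: "integrable M (?T m)" for m
    by (rule integrable_const_bound[where B = 1]) auto
  have integral_T: "(\<integral>\<omega>. ?T m \<omega> \<partial>M) = \<P>(\<omega> in M. size_on {l<..n} \<omega> = m)" for m
  proof -
    have "(\<integral>\<omega>. ?T m \<omega> \<partial>M) = (\<integral>\<omega>. indicat_real {\<omega>\<in>space M. size_on {l<..n} \<omega> = m} \<omega> \<partial>M)"
      by (intro Bochner_Integration.integral_cong) (auto simp: indicator_def)
    then show ?thesis by simp
  qed
  have indep: "indep_var borel (\<lambda>\<omega>. g m (?X \<omega>)) borel (?T m)" for m
    by (rule indep_var_size_on[where \<phi> = "\<lambda>t. if t = m then 1 else 0"])
      (simp_all del: One_nat_def, auto)
  have "(\<integral>\<omega>. h (?X \<omega>) * indicat_real {\<omega>\<in>space M. size_on {1..n} \<omega> = n} \<omega> \<partial>M) =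
      (\<integral>\<omega>. (\<Sum>m\<le>n. g m (?X \<omega>) * ?T m \<omega>) \<partial>M)"
  proof (rule Bochner_Integration.integral_cong[OF refl])
    fix \<omega> assume "\<omega> \<in> space M"
    have "{1..n} = {1..l} \<union> {l<..n}"
      using \<open>l \<le> n\<close> by auto
    then have "size_on {1..n} \<omega> = size_on {1..l} \<omega> + size_on {l<..n} \<omega>"
      unfolding size_on_def by (simp only:) (intro sum.union_disjoint; auto)
    moreover have "(\<Sum>m\<le>n. g m (?X \<omega>) * ?T m \<omega>) =
        (\<Sum>m\<le>n. if m = size_on {l<..n} \<omega> then g m (?X \<omega>) else 0)"
      by (intro sum.cong) auto
    ultimately show "h (?X \<omega>) * indicat_real {\<omega>\<in>space M. size_on {1..n} \<omega> = n} \<omega> =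
        (\<Sum>m\<le>n. g m (?X \<omega>) * ?T m \<omega>)"
      using \<open>\<omega> \<in> space M\<close> by (auto simp: g_def sX indicator_def simp del: One_nat_def)
  qed
  also have "\<dots> = (\<Sum>m\<le>n. \<integral>\<omega>. g m (?X \<omega>) * ?T m \<omega> \<partial>M)"
    by (intro Bochner_Integration.integral_sum indep_var_integrable[OF indep int_g int_T])
  also have "\<dots> = (\<Sum>m\<le>n. \<integral>\<omega>. g m (?X \<omega>) * \<P>(\<omega> in M. size_on {l<..n} \<omega> = m) \<partial>M)"
    by (simp only: indep_var_lebesgue_integral[OF indep int_g int_T] integral_T
        integral_mult_left_zero)
  also have "\<dots> = (\<integral>\<omega>. (\<Sum>m\<le>n. g m (?X \<omega>) * \<P>(\<omega> in M. size_on {l<..n} \<omega> = m)) \<partial>M)"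
    by (intro Bochner_Integration.integral_sum[symmetric] integrable_mult_left int_g)
  also have "\<dots> = (\<integral>\<omega>. h (?X \<omega>) * (if size_on {1..l} \<omega> \<le> n
      then \<P>(\<omega>' in M. size_on {l<..n} \<omega>' = n - size_on {1..l} \<omega>) else 0) \<partial>M)"
  proof (rule Bochner_Integration.integral_cong[OF refl])
    fix \<omega>
    \<comment> \<open>At most one \<open>m\<close> contributes. The inner case distinction is
      essential: for head sizes above \<open>n\<close> the subtraction yields 0, although no
      \<open>m\<close> contributes.\<close>
    have "(\<Sum>m\<le>n. g m (?X \<omega>) * \<P>(\<omega> in M. size_on {l<..n} \<omega> = m)) =
        (\<Sum>m\<le>n. if m = n - size_on {1..l} \<omega> then (if size_on {1..l} \<omega> \<le> n
          then h (?X \<omega>) * \<P>(\<omega>' in M. size_on {l<..n} \<omega>' = n - size_on {1..l} \<omega>) else 0) else 0)"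
      by (intro sum.cong) (auto simp: g_def sX simp del: One_nat_def)
    then show "(\<Sum>m\<le>n. g m (?X \<omega>) * \<P>(\<omega> in M. size_on {l<..n} \<omega> = m)) =
      h (?X \<omega>) * (if size_on {1..l} \<omega> \<le> n
        then \<P>(\<omega>' in M. size_on {l<..n} \<omega>' = n - size_on {1..l} \<omega>) else 0)"
      by (simp add: sum.delta)
  qed
  finally show ?thesis .
qed

section \<open>The law of the first counts as a reweighted Poisson law\<close>

text \<open>Up to the factor \<open>exp (\<Sum>j=1..l. a j)\<close>, this is the density of the
  conditioned head with respect to the unconditioned one, at head size \<open>s\<close>. The value 0
  for \<open>s > n\<close> guards against truncated subtraction.\<close>

definition tail_ratio :: "nat \<Rightarrow> nat \<Rightarrow> nat \<Rightarrow> real" where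
  "tail_ratio l n s = (if s \<le> n then gf_on a {l<..} $ (n - s) / gf_on a {0<..} $ n else 0)"

lemma measurable_head_uniform:
  "(\<lambda>\<omega>. \<lambda>j\<in>{1..m}. Z j \<omega>) \<in> measurable (uniform_measure M A) (\<Pi>\<^sub>M j\<in>{1..m}. count_space UNIV)"
  by (subst measurable_cong_sets[OF sets_uniform_measure refl]) (rule measurable_head)

lemma prob_conditioning_event:
  assumes "n \<ge> 1"
  shows "prob {\<omega>\<in>space M. (\<Sum>j = 1..n. j * Z j \<omega>) = n} = exp (- (\<Sum>j=1..n. a j)) * gf_on a {0<..} $ n"
  using prob_size_on_all[OF assms] by (simp add: size_on_def)

lemma prob_space_marginal_law:
  assumes "l \<le> n" "n \<ge> 1"
  shows "prob_space (marginal_law M Z l n)"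
proof -
  let ?A = "{\<omega>\<in>space M. (\<Sum>j = 1..n. j * Z j \<omega>) = n}"
  have "prob ?A > 0"
    unfolding prob_conditioning_event[OF \<open>n \<ge> 1\<close>] using gf_on_all_nth_pos by simp
  then have "prob_space (uniform_measure M ?A)"
    by (intro prob_space_uniform_measure) (simp_all add: emeasure_eq_measure)
  then show ?thesis
    unfolding marginal_law_def counting_law_def
    using measurable_head_uniform measurable_restrict_of_nat[OF \<open>l \<le> n\<close>]
    by (intro prob_space.prob_space_distr) simp_all
qed

text \<open>The expectation over the conditioning event is divided by its probability. The
  exponential factors for sizes above \<open>l\<close> cancel, leaving the tail ratio and a constant
  independent of \<open>n\<close>.\<close>

lemma integral_marginal_law:
  assumes f [measurable]: "f \<in> borel_measurable (Rl_borel l)"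
    and B: "\<And>x. x \<in> space (Rl_borel l) \<Longrightarrow> \<bar>f x\<bar> \<le> B" and "l \<le> n" "n \<ge> 1"
  shows "(\<integral>x. f x \<partial>marginal_law M Z l n) = exp (\<Sum>j=1..l. a j) *
    (\<integral>\<omega>. f (\<lambda>j\<in>{1..l}. real (Z j \<omega>)) * tail_ratio l n (size_on {1..l} \<omega>) \<partial>M)"
proof -
  let ?A = "{\<omega>\<in>space M. (\<Sum>j = 1..n. j * Z j \<omega>) = n}"
  let ?c = "gf_on a {0<..} $ n"
  have A_eq: "?A = {\<omega>\<in>space M. size_on {1..n} \<omega> = n}"
    by (simp add: size_on_def)
  have "size_on {1..n} \<in> measurable M (count_space UNIV)"
    by (intro measurable_size_on) auto
  then have [measurable]: "?A \<in> sets M"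
    unfolding A_eq by measurable
  note XM [measurable] = measurable_head
  note XU = measurable_head_uniform[of n ?A]
  note R [measurable] = measurable_restrict_of_nat
  have pA: "prob ?A = exp (- (\<Sum>j=1..n. a j)) * ?c"
    using \<open>n \<ge> 1\<close> by (rule prob_conditioning_event)
  have pA_pos: "prob ?A > 0"
    unfolding pA using gf_on_all_nth_pos by simp
  \<comment> \<open>A real-valued density turns the conditional expectation into an integral over
    \<open>M\<close>.\<close>
  have unif: "uniform_measure M ?A = density M (\<lambda>\<omega>. ennreal (indicat_real ?A \<omega> / prob ?A))"
    unfolding uniform_measure_def using pA_pos
    by (intro arg_cong[where f = "density M"])
      (auto simp: fun_eq_iff emeasure_eq_measure indicator_def divide_ennreal[symmetric])
  have indA: "(\<lambda>\<omega>. indicat_real ?A \<omega> / prob ?A) \<in> borel_measurable M"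
    by measurable
  have restr: "(\<lambda>j\<in>{1..l}. real ((\<lambda>j\<in>{1..n}. Z j \<omega>) j)) = (\<lambda>j\<in>{1..l}. real (Z j \<omega>))" for \<omega>
    using \<open>l \<le> n\<close> by (auto simp: fun_eq_iff)
  have fY: "(\<lambda>\<omega>. f (\<lambda>j\<in>{1..l}. real (Z j \<omega>))) \<in> borel_measurable M"
  proof -
    have "(\<lambda>\<omega>. f (\<lambda>j\<in>{1..l}. real ((\<lambda>j\<in>{1..n}. Z j \<omega>) j))) \<in> borel_measurable M"
      by (rule measurable_compose[OF XM measurable_compose[OF R[OF \<open>l \<le> n\<close>] f]])
    then show ?thesis unfolding restr .
  qed
  let ?h = "\<lambda>k. f (\<lambda>j\<in>{1..l}. real (k j))"
  have hX: "?h (\<lambda>j\<in>{1..l}. Z j \<omega>) = f (\<lambda>j\<in>{1..l}. real (Z j \<omega>))" for \<omega>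
    by (auto intro!: arg_cong[where f = f])
  have "(\<integral>x. f x \<partial>marginal_law M Z l n) =
      (\<integral>\<omega>. f (\<lambda>j\<in>{1..l}. real ((\<lambda>j\<in>{1..n}. Z j \<omega>) j)) \<partial>uniform_measure M ?A)"
    unfolding marginal_law_def counting_law_def using R[OF \<open>l \<le> n\<close>] XU f
    by (subst integral_distr, simp, simp, subst integral_distr)
      (auto intro!: measurable_compose[OF _ f])
  also have "\<dots> = (\<integral>\<omega>. f (\<lambda>j\<in>{1..l}. real (Z j \<omega>)) * indicat_real ?A \<omega> \<partial>M) / prob ?A"
    unfolding restr unif using fY indA
    by (subst integral_density) (auto simp: mult_ac simp flip: integral_divide_zero)
  also have "(\<integral>\<omega>. f (\<lambda>j\<in>{1..l}. real (Z j \<omega>)) * indicat_real ?A \<omega> \<partial>M) =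
      (\<integral>\<omega>. f (\<lambda>j\<in>{1..l}. real (Z j \<omega>)) * (if size_on {1..l} \<omega> \<le> n
      then \<P>(\<omega>' in M. size_on {l<..n} \<omega>' = n - size_on {1..l} \<omega>) else 0) \<partial>M)"
    unfolding A_eq
  proof (rule integral_head_size_on[of ?h l B n, unfolded hX])
    show "?h \<in> borel_measurable (\<Pi>\<^sub>M j\<in>{1..l}. count_space UNIV)"
      by (rule measurable_compose[OF R[OF order_refl] f])
    show "\<bar>f (\<lambda>j\<in>{1..l}. real (Z j \<omega>))\<bar> \<le> B" for \<omega>
      by (rule B) (simp add: space_PiM)
  qed fact
  also have "\<dots> = (\<integral>\<omega>. exp (- (\<Sum>j\<in>{l<..n}. a j)) * ?c * (f (\<lambda>j\<in>{1..l}. real (Z j \<omega>)) *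
      tail_ratio l n (size_on {1..l} \<omega>)) \<partial>M)"
    using gf_on_all_nth_pos[of n]
    by (intro Bochner_Integration.integral_cong refl) (auto simp: prob_size_on_tail tail_ratio_def)
  also have "\<dots> / prob ?A = exp (- (\<Sum>j\<in>{l<..n}. a j)) * exp (\<Sum>j=1..n. a j) *
      (\<integral>\<omega>. f (\<lambda>j\<in>{1..l}. real (Z j \<omega>)) * tail_ratio l n (size_on {1..l} \<omega>) \<partial>M)"
    unfolding pA using gf_on_all_nth_pos[of n] by (simp add: exp_minus field_simps)
  also have "exp (- (\<Sum>j\<in>{l<..n}. a j)) * exp (\<Sum>j=1..n. a j) = exp (\<Sum>j=1..l. a j)"
  proof -
    have "{1..n} = {1..l} \<union> {l<..n}"
      using \<open>l \<le> n\<close> by auto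
    then have "(\<Sum>j=1..n. a j) = (\<Sum>j=1..l. a j) + (\<Sum>j\<in>{l<..n}. a j)"
      by (simp only:) (intro sum.union_disjoint; auto)
    then show ?thesis
      by (simp add: mult_exp_exp)
  qed
  finally show ?thesis .
qed

end

section \<open>Convergence of the structure implies convergence of the ratios\<close>

text \<open>On the space of all real sequences the product and Borel sigma-algebras agree, so
  \<open>f\<close> composed with restriction is measurable there. Extension by 0 embeds the finite
  product, and restricting afterwards recovers the point.\<close>

lemma borel_measurable_continuous_map_Rl:
  assumes "continuous_map (Rl_top l) euclideanreal f"
  shows "f \<in> borel_measurable (Rl_borel l)"
proof -
  let ?r = "\<lambda>y :: nat \<Rightarrow> real. restrict y {1..l}"
  let ?e = "\<lambda>x i. if i \<in> {1..l} then x i else (0 :: real)"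
  have "continuous_map (product_topology (\<lambda>_. euclideanreal) UNIV) (Rl_top l) ?r"
    unfolding continuous_map_componentwise
    by (auto intro: continuous_map_product_projection)
  then have "continuous_map (product_topology (\<lambda>_. euclideanreal) UNIV) euclideanreal (f \<circ> ?r)"
    using assms by (rule continuous_map_compose)
  then have "continuous_on UNIV (f \<circ> ?r)"
    unfolding euclidean_product_topology by (simp add: continuous_map_iff_continuous2)
  then have "f \<circ> ?r \<in> borel_measurable borel"
    by (rule borel_measurable_continuous_onI)
  then have fr: "f \<circ> ?r \<in> borel_measurable (\<Pi>\<^sub>M i\<in>UNIV. borel)"
    by (subst measurable_cong_sets[OF sets_PiM_equal_borel refl])
  have "?e \<in> measurable (Rl_borel l) (\<Pi>\<^sub>M i\<in>UNIV. borel)"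
  proof (rule measurable_PiM_single')
    show "(\<lambda>x. if i \<in> {1..l} then x i else 0) \<in> borel_measurable (Rl_borel l)" for i
      by (cases "i \<in> {1..l}") auto
  qed auto
  then have "(\<lambda>x. (f \<circ> ?r) (?e x)) \<in> borel_measurable (Rl_borel l)"
    using fr by (rule measurable_compose)
  then show ?thesis
  proof (rule measurable_cong[THEN iffD1, rotated])
    fix x assume "x \<in> space (Rl_borel l)"
    then have "?r (?e x) = x"
      by (auto simp: space_PiM PiE_def extensional_def fun_eq_iff)
    then show "(f \<circ> ?r) (?e x) = f x"
      by simp
  qed
qed

lemma weak_conv_RlD:
  assumes "weak_conv_Rl l \<mu> \<nu>" "continuous_map (Rl_top l) euclideanreal f" "\<And>x. \<bar>f x\<bar> \<le> B"
  shows "(\<lambda>n. \<integral>x. f x \<partial>\<mu> n) \<longlonglongrightarrow> (\<integral>x. f x \<partial>\<nu>)"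
  using assms unfolding weak_conv_Rl_def bounded_iff by auto

context assembly
begin

lemma converges_imp_ratio_convergent:
  assumes "structure_converges M Z"
  obtains r where "r \<ge> 0" "(\<lambda>n. gf_on a {0<..} $ n / gf_on a {0<..} $ Suc n) \<longlonglongrightarrow> r"
proof -
  let ?c = "\<lambda>n. gf_on a {0<..} $ n"
  obtain \<nu> where "prob_space \<nu>" and sets_\<nu>: "sets \<nu> = sets (Rl_borel 1)"
    and conv: "weak_conv_Rl 1 (marginal_law M Z 1) \<nu>"
    using assms unfolding structure_converges_def by blast
  interpret \<nu>: prob_space \<nu> by fact
  have meas_\<nu>: "f \<in> borel_measurable \<nu>" if "continuous_map (Rl_top 1) euclideanreal f"
    for f :: "(nat \<Rightarrow> real) \<Rightarrow> real"
    using borel_measurable_continuous_map_Rl[OF that] by (simp add: measurable_cong_sets[OF sets_\<nu> refl])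
  have proj: "continuous_map (Rl_top 1) euclideanreal (\<lambda>x. x 1)"
    by (rule continuous_map_product_projection) simp
  \<comment> \<open>A continuous substitute for the indicator of \<open>k\<close>: among the
    integers, \<open>tent k\<close> is 1 at \<open>k\<close> and 0 elsewhere.\<close>
  define tent where "tent k x = max 0 (1 - \<bar>x 1 - real k\<bar>)" for k and x :: "nat \<Rightarrow> real"
  have tent_cont: "continuous_map (Rl_top 1) euclideanreal (tent k)" for k
    unfolding tent_def
    using proj by (intro continuous_intros) auto
  have tent_bound: "\<bar>tent k x\<bar> \<le> 1" for k x
    by (auto simp: tent_def)
  \<comment> \<open>\<open>F\<close> is 1 at every possible count and nonzero exactly for
    \<open>x 1 > -1\<close>, which is also where some tent is positive. It transports the total mass
    to the limit.\<close>
  define F where "F x = max 0 (min 1 (1 + x 1))" for x :: "nat \<Rightarrow> real"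
  have F_cont: "continuous_map (Rl_top 1) euclideanreal F"
    unfolding F_def
    using proj by (intro continuous_intros) auto
  have F_bound: "\<bar>F x\<bar> \<le> 1" for x
    by (auto simp: F_def)
  define p where "p k = (\<integral>x. tent k x \<partial>\<nu>)" for k
  have integral_tent: "(\<integral>x. tent k x \<partial>marginal_law M Z 1 n) = a 1 ^ k / fact k * tail_ratio 1 n k"
    if "n \<ge> 1" for n k
  proof -
    have "(\<integral>x. tent k x \<partial>marginal_law M Z 1 n) = exp (\<Sum>j=1..1. a j) *
        (\<integral>\<omega>. tent k (\<lambda>j\<in>{1..1}. real (Z j \<omega>)) * tail_ratio 1 n (size_on {1..1} \<omega>) \<partial>M)"
      using that by (intro integral_marginal_law[where B = 1] borel_measurable_continuous_map_Rl tent_cont tent_bound)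
    \<comment> \<open>For size 1 the head size is \<open>Z 1\<close> itself, so the tent fixes the
      argument of the tail ratio at \<open>k\<close>.\<close>
    also have "(\<integral>\<omega>. tent k (\<lambda>j\<in>{1..1}. real (Z j \<omega>)) * tail_ratio 1 n (size_on {1..1} \<omega>) \<partial>M) =
        (\<integral>\<omega>. indicat_real {\<omega>\<in>space M. size_on {1} \<omega> = k} \<omega> * tail_ratio 1 n k \<partial>M)"
    proof (intro Bochner_Integration.integral_cong refl)
      fix \<omega> assume "\<omega> \<in> space M"
      have "tent k (\<lambda>j\<in>{1..1}. real (Z j \<omega>)) = (if Z 1 \<omega> = k then 1 else 0)"
        by (auto simp: tent_def abs_real_def)
      then show "tent k (\<lambda>j\<in>{1..1}. real (Z j \<omega>)) * tail_ratio 1 n (size_on {1..1} \<omega>) =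
          indicat_real {\<omega>\<in>space M. size_on {1} \<omega> = k} \<omega> * tail_ratio 1 n k"
        using \<open>\<omega> \<in> space M\<close> by (auto simp: size_on_def)
    qed
    also have "\<dots> = \<P>(\<omega> in M. size_on {1} \<omega> = k) * tail_ratio 1 n k"
      by simp
    also have "\<dots> = exp (- a 1) * (a 1 ^ k / fact k) * tail_ratio 1 n k"
      by (subst prob_size_on_singleton) (simp_all add: gf_on_singleton)
    finally show ?thesis
      by (simp add: exp_minus)
  qed
  have tail_lim: "(\<lambda>n. tail_ratio 1 n k) \<longlonglongrightarrow> p k * fact k / a 1 ^ k" for k
  proof -
    have "(\<lambda>n. \<integral>x. tent k x \<partial>marginal_law M Z 1 n) \<longlonglongrightarrow> p k"
      unfolding p_def by (rule weak_conv_RlD[OF conv tent_cont tent_bound])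
    then have "(\<lambda>n. (\<integral>x. tent k x \<partial>marginal_law M Z 1 n) * fact k / a 1 ^ k) \<longlonglongrightarrow> p k * fact k / a 1 ^ k"
      by (intro tendsto_intros) (use param_pos[of 1] in auto)
    then show ?thesis
      by (rule Lim_transform_eventually)
        (use param_pos[of 1] in \<open>auto simp: integral_tent eventually_sequentially simp del: One_nat_def intro!: exI[of _ 1]\<close>)
  qed
  have integral_F: "(\<integral>x. F x \<partial>\<nu>) = 1"
  proof -
    have "(\<integral>x. F x \<partial>marginal_law M Z 1 n) = 1" if "n \<ge> 1" for n
    proof -
      interpret \<mu>: prob_space "marginal_law M Z 1 n"
        using that by (intro prob_space_marginal_law)
      \<comment> \<open>The integral formula evaluates a test function only at values of
        \<open>Z 1\<close>, so \<open>F\<close> integrates like the constant 1.\<close>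
      have "F (\<lambda>j\<in>{1..1}. real (Z j \<omega>)) = 1" for \<omega>
        by (simp add: F_def)
      moreover have "(\<integral>x. F x \<partial>marginal_law M Z 1 n) = exp (\<Sum>j=1..1. a j) *
          (\<integral>\<omega>. F (\<lambda>j\<in>{1..1}. real (Z j \<omega>)) * tail_ratio 1 n (size_on {1..1} \<omega>) \<partial>M)"
        using that by (intro integral_marginal_law[where B = 1] borel_measurable_continuous_map_Rl F_cont F_bound)
      moreover have "(\<integral>x. 1 \<partial>marginal_law M Z 1 n) = exp (\<Sum>j=1..1. a j) *
          (\<integral>\<omega>. 1 * tail_ratio 1 n (size_on {1..1} \<omega>) \<partial>M)"
        using that by (intro integral_marginal_law[where B = 1]) auto
      ultimately have "(\<integral>x. F x \<partial>marginal_law M Z 1 n) = (\<integral>x. 1 \<partial>marginal_law M Z 1 n)"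
        by (simp only:)
      then show ?thesis
        by (simp add: \<mu>.prob_space del: One_nat_def)
    qed
    then have "(\<lambda>n. \<integral>x. F x \<partial>marginal_law M Z 1 n) \<longlonglongrightarrow> 1"
      by (intro tendsto_eventually) (auto simp: eventually_sequentially)
    with weak_conv_RlD[OF conv F_cont F_bound] show ?thesis
      by (rule LIMSEQ_unique)
  qed
  \<comment> \<open>If every \<open>p k\<close> were 0, all tents and therefore \<open>F\<close>
    would vanish almost everywhere under \<open>\<nu>\<close>, contradicting
    \<open>integral_F\<close>.\<close>
  obtain k where k: "p k \<noteq> 0"
  proof (rule ccontr)
    assume "\<not> thesis"
    with that have p0: "p k = 0" for k by blast
    have "AE x in \<nu>. tent k x = 0" for k
    proof (rule integral_nonneg_eq_0_iff_AE[THEN iffD1])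
      show "integrable \<nu> (tent k)"
        using tent_bound by (intro \<nu>.integrable_const_bound[where B = 1] meas_\<nu> tent_cont) auto
    qed (use p0[of k] in \<open>auto simp: p_def tent_def\<close>)
    then have "AE x in \<nu>. \<forall>k. tent k x = 0"
      by (simp add: AE_all_countable)
    moreover have "F x = 0" if "\<forall>k. tent k x = 0" for x
    proof (rule ccontr)
      assume "F x \<noteq> 0"
      then have "x 1 > -1"
        by (auto simp: F_def split: if_splits)
      \<comment> \<open>For \<open>x 1\<close> in \<open>(-1, 0)\<close> the conversion to
        \<open>nat\<close> gives \<open>k = 0\<close>, which is still at distance less than
        1.\<close>
      moreover define k where "k = nat \<lfloor>x 1\<rfloor>"
      ultimately have "\<bar>x 1 - real k\<bar> < 1"
        by (cases "x 1 \<ge> 0") (simp_all add: of_nat_nat; linarith)+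
      then have "tent k x > 0"
        by (simp add: tent_def)
      with that show False by simp
    qed
    ultimately have "AE x in \<nu>. F x = 0"
      by auto
    then have "(\<integral>x. F x \<partial>\<nu>) = 0"
      by (rule integral_eq_zero_AE)
    with integral_F show False by simp
  qed
  let ?q = "\<lambda>k. p k * fact k / a 1 ^ k"
  have qk: "?q k \<noteq> 0"
    using k param_pos[of 1] by simp
  \<comment> \<open>Both tail ratios have the same numerator, since
    \<open>Suc n - Suc k = n - k\<close>. It cancels once it is nonzero, which holds eventually
    because the limit \<open>?q k\<close> is nonzero.\<close>
  have "(\<lambda>n. tail_ratio 1 (Suc n) (Suc k) / tail_ratio 1 n k) \<longlonglongrightarrow> ?q (Suc k) / ?q k"
    using tail_lim qk by (intro tendsto_divide LIMSEQ_Suc)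
  moreover have "\<forall>\<^sub>F n in sequentially. tail_ratio 1 (Suc n) (Suc k) / tail_ratio 1 n k = ?c n / ?c (Suc n)"
    using tendsto_imp_eventually_ne[OF tail_lim qk] eventually_ge_at_top[of k]
  proof eventually_elim
    case (elim n)
    then show ?case
      by (auto simp: tail_ratio_def)
  qed
  ultimately have lim: "(\<lambda>n. ?c n / ?c (Suc n)) \<longlonglongrightarrow> ?q (Suc k) / ?q k"
    by (rule Lim_transform_eventually)
  then have "?q (Suc k) / ?q k \<ge> 0"
    by (rule LIMSEQ_le_const) (intro exI[of _ 0] allI impI divide_nonneg_pos less_imp_le[OF gf_on_all_nth_pos] gf_on_all_nth_pos)
  with lim show thesis
    using that by blast
qed

end

section \<open>Convergence of the ratios implies convergence of the structure\<close>

text \<open>The quotient is a product of \<open>m\<close> consecutive ratios, each tending to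
  \<open>r\<close>. Shifting the index by \<open>m\<close> removes the case distinction before the
  induction.\<close>

lemma ratio_shift_tendsto:
  fixes c :: "nat \<Rightarrow> real"
  assumes pos: "\<And>n. c n > 0" and lim: "(\<lambda>n. c n / c (Suc n)) \<longlonglongrightarrow> r"
  shows "(\<lambda>n. if m \<le> n then c (n - m) / c n else 0) \<longlonglongrightarrow> r ^ m"
proof (rule LIMSEQ_offset)
  show "(\<lambda>n. if m \<le> n + m then c (n + m - m) / c (n + m) else 0) \<longlonglongrightarrow> r ^ m"
  proof (induction m)
    case 0
    then show ?case
      using pos by (simp add: less_imp_neq[symmetric])
  next
    case (Suc m)
    have "(\<lambda>n. c n / c (n + m) * (c (n + m) / c (Suc (n + m)))) \<longlonglongrightarrow> r ^ m * r"
      using Suc LIMSEQ_ignore_initial_segment[OF lim, of m] by (intro tendsto_mult) simp_all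
    moreover have "c n / c (n + m) * (c (n + m) / c (Suc (n + m))) = c n / c (Suc (n + m))" for n
      using pos[of "n + m"] by simp
    ultimately have "(\<lambda>n. c n / c (Suc (n + m))) \<longlonglongrightarrow> r ^ m * r"
      by (simp only:)
    then show ?case
      by (simp add: mult.commute)
  qed
qed

text \<open>The same telescoping product, now bounded factor by factor; it provides dominating
  functions uniform in \<open>n\<close>.\<close>

lemma ratio_shift_le:
  fixes c :: "nat \<Rightarrow> real"
  assumes pos: "\<And>n. c n > 0" and R: "\<And>n. c n / c (Suc n) \<le> R"
  shows "m \<le> n \<Longrightarrow> c (n - m) / c n \<le> R ^ m"
proof (induction m)
  case 0
  then show ?case
    using pos[of n] by simp
next
  case (Suc m)
  have "R \<ge> 0"
    using R[of 0] pos[of 0] pos[of "Suc 0"] by (meson divide_pos_pos less_imp_le less_le_trans)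
  have "c (n - Suc m) / c n = c (n - Suc m) / c (Suc (n - Suc m)) * (c (n - m) / c n)"
    using Suc.prems pos[of "n - m"] by (simp add: Suc_diff_Suc)
  also have "\<dots> \<le> R * R ^ m"
    using Suc \<open>R \<ge> 0\<close> pos by (intro mult_mono R) (auto intro: divide_nonneg_pos less_imp_le)
  finally show ?case
    by simp
qed

context assembly
begin

section \<open>Geometric moments of block sizes\<close>

text \<open>Against the Poisson weights, the powers of \<open>x\<close> form an exponential series,
  which converges absolutely for every real \<open>x\<close>.\<close>

lemma integrable_power_Z:
  fixes x :: real
  assumes "j \<ge> 1"
  shows "integrable M (\<lambda>\<omega>. x ^ Z j \<omega>)"
proof -
  have "summable (\<lambda>k. exp (- a j) * ((a j * \<bar>x\<bar>) ^ k / fact k))"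
    using summable_exp[of "a j * \<bar>x\<bar>"] by (intro summable_mult) (simp add: field_simps)
  moreover have "norm (pmf (poisson_pmf (a j)) k * x ^ k) = exp (- a j) * ((a j * \<bar>x\<bar>) ^ k / fact k)" for k
    using param_pos[OF assms] by (simp add: abs_mult power_abs power_mult_distrib)
  ultimately have "integrable (count_space UNIV) (\<lambda>k. pmf (poisson_pmf (a j)) k *\<^sub>R x ^ k)"
    by (simp add: integrable_count_space_nat_iff)
  then have "integrable (measure_pmf (poisson_pmf (a j))) (\<lambda>k. x ^ k)"
    unfolding measure_pmf_eq_density by (subst integrable_density) simp_all
  then have "integrable (distr M (count_space UNIV) (Z j)) (\<lambda>k. x ^ k)"
    using assms by (simp add: law_Z)
  then show ?thesis
    using assms by (subst (asm) integrable_distr_eq) (simp_all add: measurable_Z)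
qed

text \<open>The power splits into a product of independent integrable factors
  \<open>(x ^ j) ^ Z j\<close>.\<close>

lemma integrable_power_size_on:
  fixes x :: real
  assumes "finite I" "I \<subseteq> {1..}"
  shows "integrable M (\<lambda>\<omega>. x ^ size_on I \<omega>)"
proof -
  have "integrable M (\<lambda>\<omega>. \<Prod>j\<in>I. (x ^ j) ^ Z j \<omega>)"
  proof (rule indep_vars_integrable[OF \<open>finite I\<close>])
    show "indep_vars (\<lambda>_. borel) (\<lambda>j \<omega>. (x ^ j) ^ Z j \<omega>) I"
      by (rule indep_vars_compose2[OF indep_vars_subset[OF indep_Z \<open>I \<subseteq> {1..}\<close>]]) simp
  qed (use assms in \<open>auto intro!: integrable_power_Z\<close>)
  then show ?thesis
    by (simp add: size_on_def power_sum power_mult)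
qed

text \<open>The series of a finite block is entire: up to a constant its coefficients are
  probabilities, and the partial sums are bounded by the mean of
  \<open>x ^ size_on I\<close>.\<close>

lemma summable_gf_on:
  assumes "finite I" "I \<subseteq> {1..}" "x \<ge> 0"
  shows "summable (\<lambda>i. gf_on a I $ i * x ^ i)"
proof -
  note [measurable] = measurable_size_on[OF assms(2)]
  let ?P = "\<lambda>i. \<P>(\<omega> in M. size_on I \<omega> = i)"
  have int: "integrable M (indicat_real {\<omega>\<in>space M. size_on I \<omega> = i})" for i
    by (intro integrable_real_indicator) (auto simp: emeasure_eq_measure)
  have "summable (\<lambda>i. ?P i * x ^ i)"
  proof (rule summableI_nonneg_bounded)
    fix N
    have "(\<Sum>i<N. ?P i * x ^ i) =
        (\<Sum>i<N. \<integral>\<omega>. indicat_real {\<omega>\<in>space M. size_on I \<omega> = i} \<omega> * x ^ i \<partial>M)"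
      by simp
    also have "\<dots> = (\<integral>\<omega>. (\<Sum>i<N. indicat_real {\<omega>\<in>space M. size_on I \<omega> = i} \<omega> * x ^ i) \<partial>M)"
      by (intro Bochner_Integration.integral_sum[symmetric] integrable_mult_left int)
    also have "\<dots> \<le> (\<integral>\<omega>. x ^ size_on I \<omega> \<partial>M)"
    proof (rule integral_mono)
      show "integrable M (\<lambda>\<omega>. x ^ size_on I \<omega>)"
        using assms by (intro integrable_power_size_on)
      fix \<omega> assume "\<omega> \<in> space M"
      then have "(\<Sum>i<N. indicat_real {\<omega>\<in>space M. size_on I \<omega> = i} \<omega> * x ^ i) =
          (\<Sum>i<N. if i = size_on I \<omega> then x ^ i else 0)"
        by (intro sum.cong) (auto simp: indicator_def)
      then show "(\<Sum>i<N. indicat_real {\<omega>\<in>space M. size_on I \<omega> = i} \<omega> * x ^ i) \<le> x ^ size_on I \<omega>"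
        using \<open>x \<ge> 0\<close> by (simp add: sum.delta)
    qed (intro Bochner_Integration.integrable_sum integrable_mult_left int)
    finally show "(\<Sum>i<N. ?P i * x ^ i) \<le> (\<integral>\<omega>. x ^ size_on I \<omega> \<partial>M)" .
  qed (use \<open>x \<ge> 0\<close> in simp)
  then have "summable (\<lambda>i. exp (\<Sum>j\<in>I. a j) * (?P i * x ^ i))"
    by (rule summable_mult)
  moreover have "exp (\<Sum>j\<in>I. a j) * (?P i * x ^ i) = gf_on a I $ i * x ^ i" for i
    using assms by (simp add: prob_size_on exp_minus)
  ultimately show ?thesis
    by (simp only:)
qed

lemma gf_on_all_split: "gf_on a {0<..} = gf_on a {1..l} * gf_on a {l<..}"
proof -
  have "{1..l} \<union> {l<..} = {0<..}"
    by auto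
  moreover have "gf_on a ({1..l} \<union> {l<..}) = gf_on a {1..l} * gf_on a {l<..}"
    by (rule gf_on_Un) auto
  ultimately show ?thesis
    by metis
qed

text \<open>The left side is one term of a convolution of nonnegative coefficients, because the head
  series has constant coefficient 1.\<close>

lemma gf_on_tail_le: "gf_on a {l<..} $ m \<le> gf_on a {0<..} $ m"
proof -
  have nonneg: "gf_on a I $ i \<ge> 0" if "0 \<notin> I" for I i
  proof (rule gf_on_nth_nonneg)
    fix j assume "j \<in> I"
    with that have "j \<ge> 1" by (cases j) auto
    then show "a j \<ge> 0" using param_pos[of j] by simp
  qed
  have "gf_on a {l<..} $ m = (\<Sum>i\<in>{0}. gf_on a {1..l} $ i * gf_on a {l<..} $ (m - i))"
    by simp
  also have "\<dots> \<le> (\<Sum>i=0..m. gf_on a {1..l} $ i * gf_on a {l<..} $ (m - i))"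
    by (intro sum_mono2 mult_nonneg_nonneg nonneg) auto
  also have "\<dots> = gf_on a {0<..} $ m"
    unfolding gf_on_all_split[of l] by (simp add: fps_mult_nth)
  finally show ?thesis .
qed

section \<open>Limits of the marginal laws when the ratios converge\<close>

context
  fixes r R :: real
  assumes ratio_lim: "(\<lambda>n. gf_on a {0<..} $ n / gf_on a {0<..} $ Suc n) \<longlonglongrightarrow> r"
    and ratio_le: "\<And>n. gf_on a {0<..} $ n / gf_on a {0<..} $ Suc n \<le> R"
begin

text \<open>
  Dividing the generating function by \<open>exp (\<Sum>j\<le>l. a j x^j)\<close>, which is entire, perturbs the
  coefficients by an absolutely convergent series of shifts, so Tannery's theorem applies.
\<close>

lemma gf_on_tail_ratio_convergent:
  "\<exists>L. (\<lambda>n. gf_on a {l<..} $ n / gf_on a {0<..} $ n) \<longlonglongrightarrow> L"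
proof -
  let ?c = "\<lambda>n. gf_on a {0<..} $ n"
  define p where "p = Abs_fps (\<lambda>j. if j \<in> {1..l} then a j else 0)"
  define V where "V = fps_exp 1 oo (- p)"
  have p_nonneg: "p $ j \<ge> 0" for j
    using param_pos[of j] by (auto simp: p_def)
  have gf_p: "gf_on a {1..l} = fps_exp 1 oo p"
    by (simp add: gf_on_def p_def)
  \<comment> \<open>\<open>V\<close> is the reciprocal of the head series, so multiplying by it
    recovers the tail series from the full one.\<close>
  have "gf_on a {1..l} * V = 1"
    unfolding gf_p V_def using fps_exp_compose_add[of p "- p"] by (simp add: p_def)
  then have "gf_on a {l<..} = V * gf_on a {0<..}"
    unfolding gf_on_all_split[of l] by (metis mult.assoc mult.commute mult_1)
  then have tail: "gf_on a {l<..} $ n = (\<Sum>i=0..n. V $ i * ?c (n - i))" for n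
    by (simp add: fps_mult_nth)
  \<comment> \<open>Padding with 0 beyond \<open>n\<close> turns the finite convolution into a
    series whose index range does not depend on \<open>n\<close>.\<close>
  let ?f = "\<lambda>i n. V $ i * (if i \<le> n then ?c (n - i) / ?c n else 0)"
  have sum_f: "(\<Sum>i. ?f i n) = gf_on a {l<..} $ n / ?c n" for n
  proof -
    have "(\<Sum>i. ?f i n) = (\<Sum>i=0..n. ?f i n)"
      by (rule suminf_finite) auto
    then show ?thesis
      by (simp add: tail sum_divide_distrib)
  qed
  have "R \<ge> 0"
    using ratio_le[of 0] gf_on_all_nth_pos[of 0] gf_on_all_nth_pos[of "Suc 0"]
    by (meson divide_pos_pos less_imp_le less_le_trans)
  have bound: "norm (?f i n) \<le> gf_on a {1..l} $ i * R ^ i" for i n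
  proof -
    have "\<bar>V $ i\<bar> \<le> gf_on a {1..l} $ i"
      unfolding gf_p V_def by (rule abs_fps_exp_compose_uminus_le[OF p_nonneg])
    moreover have "\<bar>if i \<le> n then ?c (n - i) / ?c n else 0\<bar> \<le> R ^ i"
      using ratio_shift_le[of ?c R i n] gf_on_all_nth_pos ratio_le \<open>R \<ge> 0\<close>
      by (auto simp: less_imp_le)
    ultimately show ?thesis
      unfolding real_norm_def abs_mult by (intro mult_mono) auto
  qed
  have "\<forall>\<^sub>F (i, n) in at_top \<times>\<^sub>F sequentially. norm (?f i n) \<le> gf_on a {1..l} $ i * R ^ i"
    by (rule always_eventually) (use bound in blast)
  moreover have "summable (\<lambda>i. gf_on a {1..l} $ i * R ^ i)"
    using \<open>R \<ge> 0\<close> by (intro summable_gf_on) auto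
  moreover have "(\<lambda>n. ?f i n) \<longlonglongrightarrow> V $ i * r ^ i" for i
    by (intro tendsto_mult tendsto_const ratio_shift_tendsto gf_on_all_nth_pos ratio_lim)
  ultimately have "(\<lambda>n. \<Sum>i. ?f i n) \<longlonglongrightarrow> (\<Sum>i. V $ i * r ^ i)"
    using tannerys_theorem[of ?f "\<lambda>i. V $ i * r ^ i" sequentially "\<lambda>i. gf_on a {1..l} $ i * R ^ i"]
    by (simp only: trivial_limit_sequentially not_False_eq_True simp_thms)
  then show ?thesis
    unfolding sum_f by blast
qed

text \<open>The densities \<open>tail_ratio l n s\<close> converge to \<open>L * r ^ s\<close> and
  are dominated by \<open>R ^ s\<close>, so the integrals converge even for bounded measurable
  \<open>f\<close>; continuity enters only through measurability later.\<close>

lemma integral_marginal_law_tendsto: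
  obtains W :: "'m \<Rightarrow> real" where "\<And>\<omega>. W \<omega> \<ge> 0" "integrable M W" and
    "\<And>f B. f \<in> borel_measurable (Rl_borel l) \<Longrightarrow> (\<And>x. x \<in> space (Rl_borel l) \<Longrightarrow> \<bar>f x\<bar> \<le> B) \<Longrightarrow>
      (\<lambda>n. \<integral>x. f x \<partial>marginal_law M Z l n) \<longlonglongrightarrow> (\<integral>\<omega>. W \<omega> * f (\<lambda>j\<in>{1..l}. real (Z j \<omega>)) \<partial>M)"
proof -
  let ?c = "\<lambda>n. gf_on a {0<..} $ n" and ?A = "\<Sum>j=1..l. a j" and ?S = "size_on {1..l}"
  let ?Y = "\<lambda>\<omega>. \<lambda>j\<in>{1..l}. real (Z j \<omega>)"
  have S_meas [measurable]: "?S \<in> measurable M (count_space UNIV)"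
    by (intro measurable_size_on) auto
  have Y_meas: "?Y \<in> measurable M (Rl_borel l)"
    by (intro measurable_restrict measurable_compose[OF measurable_Z]) auto
  have c_pos: "?c n > 0" for n
    by (rule gf_on_all_nth_pos)
  have "R \<ge> 0"
    using ratio_le[of 0] c_pos[of 0] c_pos[of "Suc 0"] by (meson divide_pos_pos less_imp_le less_le_trans)
  have "r \<ge> 0"
    using ratio_lim by (rule LIMSEQ_le_const) (intro exI[of _ 0] allI impI divide_nonneg_pos less_imp_le[OF c_pos] c_pos)
  have tail_nonneg: "gf_on a {l<..} $ m \<ge> 0" for m
  proof (rule gf_on_nth_nonneg)
    fix j assume "j \<in> {l<..}"
    then show "a j \<ge> 0" using param_pos[of j] by simp
  qed
  obtain L where L: "(\<lambda>n. gf_on a {l<..} $ n / ?c n) \<longlonglongrightarrow> L"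
    using gf_on_tail_ratio_convergent by blast
  have "L \<ge> 0"
    using L by (rule LIMSEQ_le_const) (intro exI[of _ 0] allI impI divide_nonneg_pos tail_nonneg c_pos)
  \<comment> \<open>After shifting \<open>n\<close> by \<open>s\<close>, the ratio factors into tail
    coefficient over full coefficient at the same index, and a quotient of full coefficients
    \<open>s\<close> apart.\<close>
  have tail_ratio_lim: "(\<lambda>n. tail_ratio l n s) \<longlonglongrightarrow> L * r ^ s" for s
  proof (rule LIMSEQ_offset)
    have "(\<lambda>n. gf_on a {l<..} $ n / ?c n * (?c n / ?c (n + s))) \<longlonglongrightarrow> L * r ^ s"
      using LIMSEQ_ignore_initial_segment[OF ratio_shift_tendsto[OF c_pos ratio_lim, of s], of s]
      by (intro tendsto_mult L) simp
    moreover have "gf_on a {l<..} $ n / ?c n * (?c n / ?c (n + s)) = tail_ratio l (n + s) s" for n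
      using c_pos[of n] by (simp add: tail_ratio_def)
    ultimately show "(\<lambda>n. tail_ratio l (n + s) s) \<longlonglongrightarrow> L * r ^ s"
      by simp
  qed
  have tail_ratio_bound: "\<bar>tail_ratio l n s\<bar> \<le> R ^ s" for n s
  proof (cases "s \<le> n")
    case True
    have "tail_ratio l n s \<le> ?c (n - s) / ?c n"
      using True c_pos[of n] by (simp add: tail_ratio_def gf_on_tail_le divide_right_mono)
    also have "\<dots> \<le> R ^ s"
      by (rule ratio_shift_le[where c = ?c, OF c_pos ratio_le True])
    finally show ?thesis
      using True tail_nonneg c_pos[of n] by (simp add: tail_ratio_def)
  next
    case False
    then show ?thesis
      using \<open>R \<ge> 0\<close> by (simp add: tail_ratio_def)
  qed
  \<comment> \<open>This is the limit density, including the constant factor of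
    \<open>integral_marginal_law\<close>.\<close>
  define W where "W \<omega> = exp ?A * (L * r ^ ?S \<omega>)" for \<omega>
  show thesis
  proof (rule that[of W])
    show "W \<omega> \<ge> 0" for \<omega>
      using \<open>L \<ge> 0\<close> \<open>r \<ge> 0\<close> by (simp add: W_def)
    show "integrable M W"
      unfolding W_def by (intro integrable_mult_right integrable_power_size_on) auto
  next
    fix f :: "(nat \<Rightarrow> real) \<Rightarrow> real" and B
    assume f: "f \<in> borel_measurable (Rl_borel l)"
      and B: "\<And>x. x \<in> space (Rl_borel l) \<Longrightarrow> \<bar>f x\<bar> \<le> B"
    have fY [measurable]: "(\<lambda>\<omega>. f (?Y \<omega>)) \<in> borel_measurable M"
      by (rule measurable_compose[OF Y_meas f])
    have fB: "\<bar>f (?Y \<omega>)\<bar> \<le> B" for \<omega>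
      by (rule B) (simp add: space_PiM)
    have "(\<lambda>n. \<integral>\<omega>. f (?Y \<omega>) * tail_ratio l n (?S \<omega>) \<partial>M) \<longlonglongrightarrow> (\<integral>\<omega>. f (?Y \<omega>) * (L * r ^ ?S \<omega>) \<partial>M)"
    proof (rule integral_dominated_convergence[where w = "\<lambda>\<omega>. B * R ^ ?S \<omega>"])
      show "integrable M (\<lambda>\<omega>. B * R ^ ?S \<omega>)"
        by (intro integrable_mult_right integrable_power_size_on) auto
      show "AE \<omega> in M. (\<lambda>n. f (?Y \<omega>) * tail_ratio l n (?S \<omega>)) \<longlonglongrightarrow> f (?Y \<omega>) * (L * r ^ ?S \<omega>)"
        by (intro AE_I2 tendsto_mult tendsto_const tail_ratio_lim)
      have "norm (f (?Y \<omega>) * tail_ratio l n (?S \<omega>)) \<le> B * R ^ ?S \<omega>" for n \<omega>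
        unfolding real_norm_def abs_mult
        by (intro mult_mono fB tail_ratio_bound order_trans[OF abs_ge_zero fB]) simp
      then show "AE \<omega> in M. norm (f (?Y \<omega>) * tail_ratio l n (?S \<omega>)) \<le> B * R ^ ?S \<omega>" for n
        by simp
      show "(\<lambda>\<omega>. f (?Y \<omega>) * tail_ratio l n (?S \<omega>)) \<in> borel_measurable M" for n
        by (intro borel_measurable_times fY measurable_compose[OF S_meas]) simp
      show "(\<lambda>\<omega>. f (?Y \<omega>) * (L * r ^ ?S \<omega>)) \<in> borel_measurable M"
        by (intro borel_measurable_times fY measurable_compose[OF S_meas]) simp_all
    qed
    moreover have W_eq: "(\<integral>\<omega>. W \<omega> * f (?Y \<omega>) \<partial>M) = exp ?A * (\<integral>\<omega>. f (?Y \<omega>) * (L * r ^ ?S \<omega>) \<partial>M)"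
      by (subst integral_mult_right_zero[symmetric])
        (intro Bochner_Integration.integral_cong, simp_all add: W_def mult_ac)
    ultimately have "(\<lambda>n. exp ?A * (\<integral>\<omega>. f (?Y \<omega>) * tail_ratio l n (?S \<omega>) \<partial>M)) \<longlonglongrightarrow>
        (\<integral>\<omega>. W \<omega> * f (?Y \<omega>) \<partial>M)"
      unfolding W_eq by (intro tendsto_mult tendsto_const)
    moreover have "\<forall>\<^sub>F n in sequentially. exp ?A * (\<integral>\<omega>. f (?Y \<omega>) * tail_ratio l n (?S \<omega>) \<partial>M) =
        (\<integral>x. f x \<partial>marginal_law M Z l n)"
      using eventually_ge_at_top[of l] eventually_ge_at_top[of 1]
      by eventually_elim (rule integral_marginal_law[OF f B, symmetric])
    ultimately show "(\<lambda>n. \<integral>x. f x \<partial>marginal_law M Z l n) \<longlonglongrightarrow> (\<integral>\<omega>. W \<omega> * f (?Y \<omega>) \<partial>M)"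
      by (rule Lim_transform_eventually)
  qed
qed

text \<open>The limit law is the image under \<open>?Y\<close> of the measure with density
  \<open>W\<close>.\<close>

lemma ratio_convergent_imp_converges: "structure_converges M Z"
  unfolding structure_converges_def
proof (intro allI impI)
  fix l :: nat assume "l \<ge> 1"
  let ?Y = "\<lambda>\<omega>. \<lambda>j\<in>{1..l}. real (Z j \<omega>)"
  have Y_meas: "?Y \<in> measurable M (Rl_borel l)"
    by (intro measurable_restrict measurable_compose[OF measurable_Z]) auto
  show "\<exists>\<nu>. prob_space \<nu> \<and> sets \<nu> = sets (Rl_borel l) \<and> weak_conv_Rl l (marginal_law M Z l) \<nu>"
  proof (rule integral_marginal_law_tendsto[of l])
    fix W :: "'m \<Rightarrow> real"
    assume W_nonneg: "\<And>\<omega>. W \<omega> \<ge> 0" and W_int: "integrable M W" and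
      lim: "\<And>f B. f \<in> borel_measurable (Rl_borel l) \<Longrightarrow> (\<And>x. x \<in> space (Rl_borel l) \<Longrightarrow> \<bar>f x\<bar> \<le> B) \<Longrightarrow>
        (\<lambda>n. \<integral>x. f x \<partial>marginal_law M Z l n) \<longlonglongrightarrow> (\<integral>\<omega>. W \<omega> * f (?Y \<omega>) \<partial>M)"
    note W_meas [measurable] = borel_measurable_integrable[OF W_int]
    let ?D = "density M (\<lambda>\<omega>. ennreal (W \<omega>))"
    have Y_D: "?Y \<in> measurable ?D (Rl_borel l)"
      using Y_meas by simp
    \<comment> \<open>Testing with the constant 1 shows that \<open>W\<close> has integral 1,
      without evaluating \<open>L\<close>; no mass is lost in the limit.\<close>
    have "(\<lambda>n. \<integral>x. 1 \<partial>marginal_law M Z l n) \<longlonglongrightarrow> (\<integral>\<omega>. W \<omega> \<partial>M)"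
      using lim[of "\<lambda>_. 1" 1] by simp
    moreover have "\<forall>\<^sub>F n in sequentially. (\<integral>x. 1 \<partial>marginal_law M Z l n) = (1 :: real)"
      using eventually_ge_at_top[of l]
    proof eventually_elim
      case (elim n)
      interpret \<mu>: prob_space "marginal_law M Z l n"
        using elim \<open>l \<ge> 1\<close> by (intro prob_space_marginal_law) auto
      show ?case
        by (simp add: \<mu>.prob_space)
    qed
    ultimately have W_1: "(\<integral>\<omega>. W \<omega> \<partial>M) = 1"
      by (rule LIMSEQ_unique[OF _ tendsto_eventually])
    have "emeasure ?D (space ?D) = (\<integral>\<^sup>+\<omega>. ennreal (W \<omega>) \<partial>M)"
      by (subst emeasure_density) (auto intro!: nn_integral_cong)
    then have "prob_space ?D"
      by (intro prob_spaceI) (simp add: nn_integral_eq_integral[OF W_int] W_nonneg W_1)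
    then have "prob_space (distr ?D (Rl_borel l) ?Y)"
      by (rule prob_space.prob_space_distr) (rule Y_D)
    moreover have "weak_conv_Rl l (marginal_law M Z l) (distr ?D (Rl_borel l) ?Y)"
      unfolding weak_conv_Rl_def
    proof (intro allI impI, elim conjE)
      fix f assume cont: "continuous_map (Rl_top l) euclideanreal f"
        and bdd: "bounded (f ` topspace (Rl_top l))"
      have f: "f \<in> borel_measurable (Rl_borel l)"
        using cont by (rule borel_measurable_continuous_map_Rl)
      obtain B where "\<And>x. x \<in> space (Rl_borel l) \<Longrightarrow> \<bar>f x\<bar> \<le> B"
        using bdd by (auto simp: bounded_iff space_PiM)
      note conv = lim[OF f this]
      have "(\<integral>x. f x \<partial>distr ?D (Rl_borel l) ?Y) = (\<integral>\<omega>. f (?Y \<omega>) \<partial>?D)"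
        by (rule integral_distr[OF Y_D f])
      also have "\<dots> = (\<integral>\<omega>. W \<omega> * f (?Y \<omega>) \<partial>M)"
        using measurable_compose[OF Y_meas f] by (subst integral_density) (auto simp: W_nonneg)
      finally show "(\<lambda>n. \<integral>x. f x \<partial>marginal_law M Z l n) \<longlonglongrightarrow> (\<integral>x. f x \<partial>distr ?D (Rl_borel l) ?Y)"
        using conv by (simp only:)
    qed
    ultimately show ?thesis
      by (intro exI[of _ "distr ?D (Rl_borel l) ?Y"]) simp
  qed
qed

end

end

theorem proposition3:
  fixes M :: "'m measure" and a :: "nat \<Rightarrow> real" and Z :: "nat \<Rightarrow> 'm \<Rightarrow> nat"
  assumes "assembly M a Z"
  shows "structure_converges M Z \<longleftrightarrow>
    (\<exists>\<rho>::ereal. 0 \<le> \<rho> \<and> \<rho> < \<infinity> \<and> fps_nth (assembly_gf a) \<in> RT \<rho>)"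
proof -
  interpret assembly M a Z by fact
  let ?c = "\<lambda>n. gf_on a {0<..} $ n"
  \<comment> \<open>Since all coefficients are positive, the nonnegativity and nonvanishing clauses
    of \<open>RT\<close> hold automatically.\<close>
  have RT_iff: "fps_nth (assembly_gf a) \<in> RT (ereal r) \<longleftrightarrow> (\<lambda>n. ?c n / ?c (Suc n)) \<longlonglongrightarrow> r" for r
    using gf_on_all_nth_pos
    by (simp add: RT_def assembly_gf_eq_gf_on less_imp_le less_imp_neq[symmetric])
  show ?thesis
  proof
    assume "structure_converges M Z"
    then obtain r where "r \<ge> 0" "(\<lambda>n. ?c n / ?c (Suc n)) \<longlonglongrightarrow> r"
      by (rule converges_imp_ratio_convergent)
    then show "\<exists>\<rho>::ereal. 0 \<le> \<rho> \<and> \<rho> < \<infinity> \<and> fps_nth (assembly_gf a) \<in> RT \<rho>"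
      by (intro exI[of _ "ereal r"]) (simp add: RT_iff)
  next
    assume "\<exists>\<rho>::ereal. 0 \<le> \<rho> \<and> \<rho> < \<infinity> \<and> fps_nth (assembly_gf a) \<in> RT \<rho>"
    then obtain \<rho> :: ereal where \<rho>: "0 \<le> \<rho>" "\<rho> < \<infinity>" "fps_nth (assembly_gf a) \<in> RT \<rho>"
      by blast
    then obtain r where "\<rho> = ereal r"
      by (cases \<rho>) auto
    with \<rho> have lim: "(\<lambda>n. ?c n / ?c (Suc n)) \<longlonglongrightarrow> r"
      by (simp add: RT_iff)
    \<comment> \<open>Domination must hold for every \<open>n\<close>, so the limit is complemented
      by a uniform bound, available for any convergent sequence.\<close>
    then obtain R where "\<And>n. \<bar>?c n / ?c (Suc n)\<bar> \<le> R"
      using convergent_imp_Bseq[OF convergentI[OF lim]] by (auto simp: Bseq_def)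
    then have "?c n / ?c (Suc n) \<le> R" for n
      by (rule order_trans[OF abs_ge_self])
    with lim show "structure_converges M Z"
      by (rule ratio_convergent_imp_converges)
  qed
qed

end
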